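(* Let $n\ge 2$ and $d\ge 1$ be integers and let $q=2^d$. Define $$\nu(n,d)=\begin{cases} q^{\binom n2}\displaystyle\prod_{j=1}^{\lceil (n-1)/2\rceil}\left(1-q^{1-2j}\right) & \text{if } n \text{ is even},\\[2mm] \left(q^{n-1}-2^{n-1}\right)q^{\binom{n-1}{2}}\displaystyle\prod_{j=1}^{\lceil (n-2)/2\rceil}\left(1-q^{1-2j}\right) & \text{if } n \text{ is odd}.\end{cases}$$ Then $\nu(n,d)\le |\mathcal M_{n,d}|$.
   Context: $\mathcal M_{n,d}$ denotes the set of all matrices $\mathfrak B\in(\mathbb F_{2^d})^{n\times n}$ satisfying the three conditions: (I) $\mathfrak B$ has full rank $n$ over $\mathbb F_2$ when regarded as an element of $(\mathbb F_2)^{n\times nd}$ by identifying each entry in $\mathbb F_{2^d}$ with its coordinate row vector in $(\mathbb F_2)^d$ with respect to a fixed $\mathbb F_2$-basis (equivalently, no nonempty subset of the rows of $\mathfrak B$ sums to zero); (II) $\mathfrak B$ is symmetric; (III) all diagonal entries of $\mathfrak B$ are zero. *)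

theory Defs
  imports
    Complex_Main
    "HOL-Library.Cardinality"
    "HOL-Library.Z2"
    "HOL-Number_Theory.Residues"
    "Jordan_Normal_Form.DL_Rank"
begin

text \<open>
  The field of order \<open>2 ^ d\<close> is a type \<open>'a :: {field, finite}\<close> with \<open>CARD('a) = 2 ^ d\<close>; the
  prime field is the type \<open>bit\<close>. The function below is the scalar multiplication of \<open>bit\<close> on
  \<open>'a\<close>; it is a vector space structure because \<open>'a\<close> has characteristic 2.
\<close>

definition F2_scale :: "bit \<Rightarrow> 'a::field \<Rightarrow> 'a" where
  "F2_scale c x = of_bit c * x"

lemma vector_space_F2_scale:
  assumes "CARD('a::{field,finite}) = 2 ^ d"
  shows "Vector_Spaces.vector_space (F2_scale :: bit \<Rightarrow> 'a \<Rightarrow> 'a)"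
proof -
  have "CHAR('a) > 0"
    by (rule finite_imp_CHAR_pos) simp
  hence "prime CHAR('a)"
    by (rule prime_CHAR_semidom)
  moreover have "CHAR('a) dvd 2 ^ d"
    using CHAR_dvd_CARD assms by metis
  ultimately have "CHAR('a) = 2"
    by (metis prime_dvd_power primes_dvd_imp_eq two_is_prime_nat)
  hence two: "(2::'a) = 0"
    using of_nat_CHAR by (metis of_nat_numeral)
  have dbl: "x + x = 0" for x :: 'a
    using two by (metis mult_2 mult_zero_left)
  show ?thesis
  proof
    fix a b :: bit and x y :: 'a
    show "F2_scale a (x + y) = F2_scale a x + F2_scale a y"
      by (simp add: F2_scale_def distrib_left)
    show "F2_scale (a + b) x = F2_scale a x + F2_scale b x"
      by (cases a; cases b) (auto simp: F2_scale_def dbl)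
    show "F2_scale a (F2_scale b x) = F2_scale (a * b) x"
      by (cases a; cases b) (auto simp: F2_scale_def)
    show "F2_scale 1 x = x" by (simp add: F2_scale_def)
  qed
qed

definition is_F2_basis :: "nat \<Rightarrow> 'a::field list \<Rightarrow> bool" where
  "is_F2_basis d bs \<longleftrightarrow> length bs = d \<and> distinct bs \<and>
     \<not> Modules.module.dependent F2_scale (set bs) \<and>
     Modules.module.span F2_scale (set bs) = UNIV"

definition F2_coord :: "'a::field list \<Rightarrow> 'a \<Rightarrow> nat \<Rightarrow> bit" where
  "F2_coord bs x k = Modules.module.representation F2_scale (set bs) x (bs ! k)"

text \<open>
  Each entry is replaced by its coordinate row vector, so that column \<open>j * d + k\<close> of the
  resulting matrix holds the \<open>k\<close>-th coordinates of column \<open>j\<close>, where \<open>d = length bs\<close>.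
\<close>

definition F2_expand :: "'a::field list \<Rightarrow> 'a mat \<Rightarrow> bit mat" where
  "F2_expand bs B = mat (dim_row B) (dim_col B * length bs)
     (\<lambda>(i, c). F2_coord bs (B $$ (i, c div length bs)) (c mod length bs))"

text \<open>In \<open>vec_space.rank n A\<close> the argument \<open>n\<close> is the number of rows of \<open>A\<close>.\<close>

definition M_set :: "nat \<Rightarrow> 'a::field list \<Rightarrow> 'a mat set" where
  "M_set n bs = {B \<in> carrier_mat n n.
     vec_space.rank n (F2_expand bs B) = n \<and>
     transpose_mat B = B \<and>
     (\<forall>i<n. B $$ (i, i) = 0)}"

lemma finite_M_set: "finite (M_set n (bs :: 'a::{field,finite} list))"
proof (rule finite_subset)
  let ?I = "{..<n} \<times> {..<n}"
  show "M_set n bs \<subseteq> mat n n ` (?I \<rightarrow>\<^sub>E (UNIV :: 'a set))"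
  proof
    fix B assume "B \<in> M_set n bs"
    hence B: "mat n n (restrict (($$) B) ?I) = B"
      by (intro eq_matI) (auto simp: M_set_def)
    have "restrict (($$) B) ?I \<in> ?I \<rightarrow>\<^sub>E UNIV" by simp
    from imageI[OF this, of "mat n n"]
    show "B \<in> mat n n ` (?I \<rightarrow>\<^sub>E (UNIV :: 'a set))" by (simp only: B)
  qed
  show "finite (mat n n ` (?I \<rightarrow>\<^sub>E (UNIV :: 'a set)))"
    by (intro finite_imageI finite_PiE finite_cartesian_product finite_lessThan finite)
qed

definition nu :: "nat \<Rightarrow> nat \<Rightarrow> real" where
  "nu n d = (let q = (2::real) ^ d in
     if even n then
       q ^ (n choose 2) *
         (\<Prod>j = 1..nat \<lceil>(real n - 1) / 2\<rceil>. 1 - q powi (1 - 2 * int j))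
     else
       (q ^ (n - 1) - 2 ^ (n - 1)) * q ^ ((n - 1) choose 2) *
         (\<Prod>j = 1..nat \<lceil>(real n - 2) / 2\<rceil>. 1 - q powi (1 - 2 * int j)))"

end

theory Submission
  imports Defs
begin

text \<open>
  For even \<open>n\<close> it suffices to count nondegenerate alternating forms over the field of order \<open>q\<close>,
  since these satisfy (I) even with coefficients in the large field. Fix an index \<open>a\<close>. Choose a
  nonzero row \<open>v\<close> at \<open>a\<close>, a pivot \<open>b\<close> with \<open>v b \<noteq> 0\<close>, a row \<open>w\<close> at \<open>b\<close> with \<open>w a = v b\<close>, and a
  nondegenerate form \<open>g\<close> on the remaining indices (the Schur complement). Then
  \<open>f i j = g i j + (v i * w j + w i * v j) / v b\<close> is nondegenerate with rows \<open>v\<close> and \<open>w\<close>, so \<open>f\<close>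
  determines the data. This gives \<open>(q ^ (n - 1) - 1) * q ^ (n - 2)\<close> times the count for \<open>n - 2\<close>.

  For odd \<open>n\<close>, border a nondegenerate form \<open>f\<close> on \<open>n - 1\<close> indices by a row \<open>b\<close>. A set of rows of
  the bordered matrix can sum to zero only if \<open>b\<close> is a sum of rows of \<open>f\<close>, which excludes at
  most \<open>2 ^ (n - 1)\<close> choices of \<open>b\<close>.
\<close>

section \<open>Row independence and column rank\<close>

text \<open>\<open>rank\<close> is defined through columns, so independence of the rows has to be
  transferred. In the reduced echelon form \<open>C = P * A\<close> a zero row would be a relation
  among the rows of \<open>A\<close>, so every row has a pivot. The pivot columns of
  \<open>C\<close> are unit vectors, hence the same columns of \<open>A = Q * C\<close> are the
  columns of the invertible \<open>Q\<close>: \<open>n\<close> independent columns.\<close>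

lemma rank_eq_dim_row:
  fixes A :: "'a::field mat"
  assumes A: "A \<in> carrier_mat n nc"
    and inj: "\<And>v. v \<in> carrier_vec n \<Longrightarrow> transpose_mat A *\<^sub>v v = 0\<^sub>v nc \<Longrightarrow> v = 0\<^sub>v n"
  shows "vec_space.rank n A = n"
proof -
  interpret vec_space "TYPE('a)" n .
  obtain C where C: "gauss_jordan_single A = C" by simp
  from gauss_jordan_single[OF A C] obtain P Q
    where carC: "C \<in> carrier_mat n nc" and ref: "row_echelon_form C" and CP: "C = P * A"
      and PQ: "P * Q = 1\<^sub>m n" and QP: "Q * P = 1\<^sub>m n"
      and P: "P \<in> carrier_mat n n" and Q: "Q \<in> carrier_mat n n"
    by metis
  have dimC: "dim_row C = n" using carC by simp
  from ref carC obtain f where piv: "pivot_fun C f nc"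
    unfolding row_echelon_form_def by auto
  note pD = pivot_funD[OF dimC piv]
  have AQC: "A = Q * C"
    using assoc_mult_mat[OF Q P A] A QP CP by simp
  have fnc: "f i < nc" if i: "i < n" for i
  proof (rule ccontr)
    assume "\<not> f i < nc"
    hence "row C i = 0\<^sub>v nc"
      using pivot_fun_zero_row_iff[OF piv carC i] pD(1)[OF i] by auto
    \<comment> \<open>Row \<open>i\<close> of \<open>P * A\<close> combines the rows of
      \<open>A\<close> with the coefficients \<open>row P i\<close>, so \<open>inj\<close> forces
      \<open>row P i\<close> to be zero, which an invertible \<open>P\<close> excludes.\<close>
    moreover have "row C i = transpose_mat A *\<^sub>v row P i"
      using i P A by (intro eq_vecI) (auto simp: CP scalar_prod_def mult.commute)
    ultimately have "row P i = 0\<^sub>v n"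
      using inj[of "row P i"] P i by auto
    hence "(P * Q) $$ (i, i) = 0"
      using i P Q by auto
    thus False using PQ i by simp
  qed
  have colC: "col C (f i) = unit_vec n i" if i: "i < n" for i
    using fnc[OF i] carC pD(4)[OF i fnc[OF i]] pD(5)[OF i fnc[OF i]] i
    by (intro eq_vecI) (auto simp: unit_vec_def)
  have colA: "col A (f i) = col Q i" if i: "i < n" for i
  proof -
    have "col A (f i) = Q *\<^sub>v col C (f i)"
      unfolding AQC using fnc[OF i] carC Q by (subst col_mult2) auto
    also have "\<dots> = col Q i"
      unfolding colC[OF i] using Q i by (intro eq_vecI) auto
    finally show ?thesis .
  qed
  have sub: "set (cols Q) \<subseteq> set (cols A)"
  proof
    fix x assume "x \<in> set (cols Q)"
    then obtain i where i: "i < n" "x = col Q i"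
      using Q by (auto simp: cols_def)
    thus "x \<in> set (cols A)"
      using colA[OF i(1)] fnc[OF i(1)] A by (auto simp: cols_def intro: image_eqI[of _ _ "f i"])
  qed
  have "det Q * det P = 1"
    using det_mult[OF Q P] QP by simp
  hence "det Q \<noteq> 0" by auto
  hence rQ: "rank Q = n" using det_rank_iff[OF Q] by simp
  have distQ: "distinct (cols Q)" using non_distinct_low_rank[OF Q] rQ by auto
  have liQ: "lin_indpt (set (cols Q))"
    using full_rank_lin_indpt[OF Q rQ distQ] .
  have "card (set (cols Q)) = n" using distinct_card[OF distQ] Q by simp
  hence "n \<le> rank A" using rank_ge_card_indpt[OF A sub liQ] by simp
  moreover have "rank A \<le> n"
  proof -
    \<comment> \<open>The rank is the size of a maximal independent set of columns, and such a set
      lives in an \<open>n\<close>-dimensional space.\<close>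
    obtain S where S: "maximal S (\<lambda>T. T \<subseteq> set (cols A) \<and> lin_indpt T)"
      using maximal_exists_superset[of "set (cols A)" "\<lambda>T. T \<subseteq> set (cols A) \<and> lin_indpt T" "set (cols Q)"]
        sub liQ by auto
    hence "S \<subseteq> carrier_vec n" "lin_indpt S"
      using cols_dim[of A] A unfolding maximal_def by auto
    hence "card S \<le> n" using li_le_dim(2)[OF fin_dim, of S] dim_is_n by auto
    thus ?thesis using rank_card_indpt[OF A S] by simp
  qed
  ultimately show ?thesis by simp
qed

section \<open>Alternating and symplectic forms on a finite index set\<close>

text \<open>
  Vectors and forms on \<open>I\<close> are extended by zero, so that equality of functions is equality on \<open>I\<close>.
  In \<open>alt_on\<close> symmetry replaces antisymmetry, which is the same in characteristic 2.
\<close>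

definition vec_on :: "'i set \<Rightarrow> ('i \<Rightarrow> 'a::zero) set" where
  "vec_on I = {v. \<forall>i. i \<notin> I \<longrightarrow> v i = 0}"

definition alt_on :: "'i set \<Rightarrow> ('i \<Rightarrow> 'i \<Rightarrow> 'a::zero) set" where
  "alt_on I = {f. (\<forall>i j. f i j = f j i) \<and> (\<forall>i. f i i = 0) \<and> (\<forall>i j. i \<notin> I \<longrightarrow> f i j = 0)}"

definition symplectic_on :: "'i set \<Rightarrow> ('i \<Rightarrow> 'i \<Rightarrow> 'a::comm_ring) set" where
  "symplectic_on I = {f \<in> alt_on I.
     \<forall>x. (\<forall>j\<in>I. (\<Sum>i\<in>I. x i * f i j) = 0) \<longrightarrow> (\<forall>i\<in>I. x i = 0)}"

lemma symplectic_on_imp_alt_on: "f \<in> symplectic_on I \<Longrightarrow> f \<in> alt_on I"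
  by (simp add: symplectic_on_def)

lemma alt_on_eq_0:
  assumes "f \<in> alt_on I" and "i \<notin> I \<or> j \<notin> I"
  shows "f i j = 0"
proof -
  have "f i j = f j i" "i \<notin> I \<Longrightarrow> f i j = 0" "j \<notin> I \<Longrightarrow> f j i = 0"
    using assms(1) unfolding alt_on_def by blast+
  thus ?thesis using assms(2) by auto
qed

lemma vec_on_eq_image:
  fixes I :: "'i set"
  shows "vec_on I = (\<lambda>f i. if i \<in> I then f i else 0) ` (I \<rightarrow>\<^sub>E UNIV)"
proof (intro equalityI subsetI)
  fix v :: "'i \<Rightarrow> 'a::zero" assume "v \<in> vec_on I"
  hence "v = (\<lambda>i. if i \<in> I then restrict v I i else 0)"
    by (auto simp: vec_on_def)
  thus "v \<in> (\<lambda>f i. if i \<in> I then f i else 0) ` (I \<rightarrow>\<^sub>E UNIV)"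
    by (intro image_eqI[of _ _ "restrict v I"]) auto
qed (auto simp: vec_on_def)

lemma card_vec_on:
  assumes "finite I"
  shows "card (vec_on I :: ('i \<Rightarrow> 'a::{zero,finite}) set) = CARD('a) ^ card I"
proof -
  have "inj_on (\<lambda>f i. if i \<in> I then f i else (0::'a)) (I \<rightarrow>\<^sub>E UNIV)"
  proof (rule inj_onI)
    fix f g :: "'i \<Rightarrow> 'a"
    assume fg: "f \<in> I \<rightarrow>\<^sub>E UNIV" "g \<in> I \<rightarrow>\<^sub>E UNIV"
      and eq: "(\<lambda>i. if i \<in> I then f i else 0) = (\<lambda>i. if i \<in> I then g i else 0)"
    show "f = g"
    proof (rule PiE_ext[OF fg])
      fix i assume "i \<in> I" thus "f i = g i" using fun_cong[OF eq, of i] by simp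
    qed
  qed
  thus ?thesis
    unfolding vec_on_eq_image by (simp add: card_image card_PiE assms)
qed

lemma finite_vec_on: "finite I \<Longrightarrow> finite (vec_on I :: ('i \<Rightarrow> 'a::{zero,finite}) set)"
  unfolding vec_on_eq_image by (intro finite_imageI finite_PiE) auto

lemma finite_alt_on:
  assumes "finite I"
  shows "finite (alt_on I :: ('i \<Rightarrow> 'i \<Rightarrow> 'a::{zero,finite}) set)"
proof (rule finite_subset)
  show "alt_on I \<subseteq> (curry :: ('i \<times> 'i \<Rightarrow> 'a) \<Rightarrow> _) ` vec_on (I \<times> I)"
  proof
    fix f :: "'i \<Rightarrow> 'i \<Rightarrow> 'a" assume "f \<in> alt_on I"
    hence "\<And>i j. i \<notin> I \<Longrightarrow> f i j = 0" "\<And>i j. f i j = f j i"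
      unfolding alt_on_def by blast+
    hence "case_prod f \<in> vec_on (I \<times> I)" unfolding vec_on_def by force
    thus "f \<in> curry ` vec_on (I \<times> I)" by (intro image_eqI[of _ _ "case_prod f"]) auto
  qed
  show "finite ((curry :: ('i \<times> 'i \<Rightarrow> 'a) \<Rightarrow> _) ` vec_on (I \<times> I))"
    using assms by (intro finite_imageI finite_vec_on) auto
qed

lemma finite_symplectic_on:
  "finite I \<Longrightarrow> finite (symplectic_on I :: ('i \<Rightarrow> 'i \<Rightarrow> 'a::{comm_ring,finite}) set)"
  by (rule finite_subset[OF _ finite_alt_on[of I]]) (auto simp: symplectic_on_def)

section \<open>Extension by two indices and the count of symplectic forms\<close>

text \<open>This inverts the Schur complement: if the block on \<open>a\<close>, \<open>b\<close>
  has zero diagonal and off-diagonal entry \<open>v b\<close>, its inverse has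
  \<open>1 / v b\<close> off the diagonal, which yields the added term.\<close>

definition extend_form :: "'i \<Rightarrow> 'i \<Rightarrow> ('i \<Rightarrow> 'a::field) \<Rightarrow> ('i \<Rightarrow> 'a) \<Rightarrow> ('i \<Rightarrow> 'i \<Rightarrow> 'a) \<Rightarrow> 'i \<Rightarrow> 'i \<Rightarrow> 'a" where
  "extend_form a b v w g i j = g i j + (v i * w j + w i * v j) / v b"

text \<open>A kernel vector \<open>x\<close>, tested at columns \<open>a\<close> and
  \<open>b\<close>, pairs to 0 with \<open>v\<close> and \<open>w\<close>. This removes the added
  term at every column, so \<open>x\<close> restricted to the other indices lies in the kernel of
  \<open>g\<close> and vanishes there.\<close>

lemma extend_form_symplectic:
  fixes g :: "'i \<Rightarrow> 'i \<Rightarrow> 'a::field"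
  assumes two: "(2::'a) = 0" and I: "finite I" and ab: "a \<in> I" "b \<in> I" "a \<noteq> b"
    and v: "v \<in> vec_on I" "v a = 0" "v b \<noteq> 0"
    and w: "w \<in> vec_on I" "w a = v b" "w b = 0"
    and g: "g \<in> symplectic_on (I - {a, b})"
  shows "extend_form a b v w g \<in> symplectic_on I"
    and "extend_form a b v w g a = v"
    and "extend_form a b v w g b = w"
proof -
  let ?f = "extend_form a b v w g"
  let ?J = "I - {a, b}"
  have dbl: "x + x = 0" for x :: 'a
    using two by (metis mult_2 mult_zero_left)
  have gs: "g i j = g j i" and gd: "g i i = 0" and g0: "i \<notin> ?J \<Longrightarrow> g i j = 0" for i j
    using g unfolding symplectic_on_def alt_on_def by blast+
  have g0': "j \<notin> ?J \<Longrightarrow> g i j = 0" for i j using gs g0 by metis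
  have gnd: "\<And>x. (\<forall>j\<in>?J. (\<Sum>i\<in>?J. x i * g i j) = 0) \<Longrightarrow> \<forall>i\<in>?J. x i = 0"
    using g unfolding symplectic_on_def by blast
  have v0: "i \<notin> I \<Longrightarrow> v i = 0" and w0: "i \<notin> I \<Longrightarrow> w i = 0" for i
    using v w by (auto simp: vec_on_def)
  show fa: "?f a = v" using v w g0[of a] by (auto simp: extend_form_def)
  show fb: "?f b = w" using v w g0[of b] by (auto simp: extend_form_def)
  have alt: "?f \<in> alt_on I"
  proof -
    have "?f i j = ?f j i" for i j
      using gs[of i j] by (simp add: extend_form_def algebra_simps)
    moreover have "?f i i = 0" for i
      using gd[of i] dbl[of "v i * w i"] by (simp add: extend_form_def mult.commute)
    moreover have "?f i j = 0" if "i \<notin> I" for i j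
      using that g0[of i j] v0[OF that] w0[OF that] by (simp add: extend_form_def)
    ultimately show ?thesis unfolding alt_on_def by blast
  qed
  hence fs: "?f i a = ?f a i" "?f i b = ?f b i" for i
    unfolding alt_on_def by blast+
  have "\<forall>i\<in>I. x i = 0" if x: "\<forall>j\<in>I. (\<Sum>i\<in>I. x i * ?f i j) = 0" for x
  proof -
    define X where "X = (\<Sum>i\<in>I. x i * v i)"
    define Y where "Y = (\<Sum>i\<in>I. x i * w i)"
    have "(\<Sum>i\<in>I. x i * ?f i a) = X" "(\<Sum>i\<in>I. x i * ?f i b) = Y"
      unfolding X_def Y_def using fs fun_cong[OF fa] fun_cong[OF fb] by simp_all
    hence X: "X = 0" and Y: "Y = 0" using x ab by auto
    have "(\<Sum>i\<in>?J. x i * g i j) = 0" if j: "j \<in> I" for j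
    proof -
      have "0 = (\<Sum>i\<in>I. x i * ?f i j)" using x j by simp
      also have "\<dots> = (\<Sum>i\<in>I. x i * g i j) + (X * w j + Y * v j) / v b"
        unfolding X_def Y_def extend_form_def sum_distrib_right sum_divide_distrib
          sum.distrib[symmetric] by (intro sum.cong) (simp_all add: algebra_simps add_divide_distrib)
      also have "\<dots> = (\<Sum>i\<in>I. x i * g i j)" by (simp add: X Y)
      also have "\<dots> = (\<Sum>i\<in>?J. x i * g i j)"
        using I g0 by (intro sum.mono_neutral_right) auto
      finally show ?thesis by simp
    qed
    hence xJ: "\<forall>i\<in>?J. x i = 0" using gnd[of x] by simp
    \<comment> \<open>Only \<open>a\<close> and \<open>b\<close> still contribute: as
      \<open>v a = 0\<close> and \<open>w b = 0\<close>, the pairing with \<open>v\<close> is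
      \<open>x b * v b\<close> and the pairing with \<open>w\<close> is
      \<open>x a * w a = x a * v b\<close>.\<close>
    have "(\<Sum>i\<in>I. x i * u i) = (\<Sum>i\<in>{a,b}. x i * u i)" for u
      using I ab xJ by (intro sum.mono_neutral_right) auto
    from this[of v] this[of w] have "x b * v b = 0" "x a * v b = 0"
      using X Y ab(3) v(2) w(2,3) by (simp_all add: X_def Y_def)
    hence "x b = 0" "x a = 0" using v(3) by simp_all
    thus ?thesis using xJ by auto
  qed
  with alt show "?f \<in> symplectic_on I"
    unfolding symplectic_on_def by blast
qed

text \<open>The data \<open>(v, w, g)\<close> are mapped injectively to forms. If
  \<open>card I = 1\<close>, the first factor is 0, so the truncated \<open>card I - 2\<close> is
  harmless.\<close>

lemma card_symplectic_on_step:
  fixes I :: "'i set"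
  assumes two: "(2::'a::{field,finite}) = 0" and I: "finite I" and a: "a \<in> I"
    and N: "\<And>b. b \<in> I \<Longrightarrow> b \<noteq> a \<Longrightarrow> N \<le> card (symplectic_on (I - {a, b}) :: ('i \<Rightarrow> 'i \<Rightarrow> 'a) set)"
  shows "(CARD('a) ^ (card I - 1) - 1) * (CARD('a) ^ (card I - 2) * N)
    \<le> card (symplectic_on I :: ('i \<Rightarrow> 'i \<Rightarrow> 'a) set)"
proof -
  define V :: "('i \<Rightarrow> 'a) set" where "V = vec_on (I - {a}) - {\<lambda>_. 0}"
  \<comment> \<open>The pivot depends on \<open>v\<close> alone, so two forms with the same row at
    \<open>a\<close> use the same pivot.\<close>
  define p where "p v = (SOME b. v b \<noteq> 0)" for v :: "'i \<Rightarrow> 'a"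
  have p: "v (p v) \<noteq> 0" "p v \<in> I" "p v \<noteq> a" if "v \<in> V" for v
  proof -
    have "\<exists>b. v b \<noteq> 0" using that by (auto simp: V_def)
    thus 1: "v (p v) \<noteq> 0" unfolding p_def by (rule someI_ex)
    show "p v \<in> I" "p v \<noteq> a" using 1 that by (auto simp: V_def vec_on_def)
  qed
  \<comment> \<open>The entry of the second row at \<open>a\<close> is forced to be
    \<open>v (p v)\<close>. It is stored as 0 and restored by \<open>h\<close>, leaving
    \<open>card I - 2\<close> free entries.\<close>
  define D where "D = (SIGMA v:V. (vec_on (I - {a, p v}) :: ('i \<Rightarrow> 'a) set) \<times>
    (symplectic_on (I - {a, p v}) :: ('i \<Rightarrow> 'i \<Rightarrow> 'a) set))"
  define h where "h = (\<lambda>(v, w, g). extend_form a (p v) v (w(a := v (p v))) g)"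
  have finV: "finite V" unfolding V_def using I by (auto intro: finite_vec_on)
  have "(\<lambda>_. 0) \<in> (vec_on (I - {a}) :: ('i \<Rightarrow> 'a) set)" by (simp add: vec_on_def)
  hence cardV: "card V = CARD('a) ^ (card I - 1) - 1"
    unfolding V_def using I a by (simp add: card_vec_on)
  have ext: "h (v, w, g) \<in> symplectic_on I \<and> h (v, w, g) a = v \<and> h (v, w, g) (p v) = w(a := v (p v))"
    if "v \<in> V" "w \<in> vec_on (I - {a, p v})" "g \<in> symplectic_on (I - {a, p v})" for v w g
  proof -
    have "v \<in> vec_on I" "v a = 0" "w(a := v (p v)) \<in> vec_on I" "(w(a := v (p v))) (p v) = 0"
      using that a p[OF that(1)] by (auto simp: V_def vec_on_def)
    with extend_form_symplectic[OF two I a, of "p v" v "w(a := v (p v))" g] that p[OF that(1)]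
    show ?thesis by (auto simp: h_def)
  qed
  have inj: "inj_on h D"
  proof (rule inj_onI)
    fix s t assume s: "s \<in> D" and t: "t \<in> D" and eq: "h s = h t"
    obtain v w g where s': "s = (v, w, g)" by (cases s)
    obtain v' w' g' where t': "t = (v', w', g')" by (cases t)
    have S: "v \<in> V" "w \<in> vec_on (I - {a, p v})" "g \<in> symplectic_on (I - {a, p v})"
      using s s' by (auto simp: D_def)
    have T: "v' \<in> V" "w' \<in> vec_on (I - {a, p v'})" "g' \<in> symplectic_on (I - {a, p v'})"
      using t t' by (auto simp: D_def)
    \<comment> \<open>The row at \<open>a\<close> gives \<open>v\<close> and thus the pivot; the row
      at the pivot gives \<open>w\<close>; subtracting the common added term gives
      \<open>g\<close>.\<close>
    have v: "v' = v" using ext[OF S] ext[OF T] eq s' t' by metis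
    have "w(a := v (p v)) = w'(a := v (p v))" using ext[OF S] ext[OF T] eq s' t' v by metis
    moreover have "w a = 0" "w' a = 0" using S T by (auto simp: vec_on_def)
    ultimately have w: "w' = w" by (metis fun_upd_triv fun_upd_upd)
    have "g' i j = g i j" for i j
      using fun_cong[OF fun_cong[OF eq], of i j] by (simp add: s' t' v w h_def extend_form_def)
    hence "g' = g" by blast
    thus "s = t" using s' t' v w by simp
  qed
  have "(CARD('a) ^ (card I - 1) - 1) * (CARD('a) ^ (card I - 2) * N)
      = (\<Sum>v\<in>V. CARD('a) ^ (card I - 2) * N)"
    by (simp add: cardV)
  also have "\<dots> \<le> (\<Sum>v\<in>V. card ((vec_on (I - {a, p v}) :: ('i \<Rightarrow> 'a) set) \<times>
    (symplectic_on (I - {a, p v}) :: ('i \<Rightarrow> 'i \<Rightarrow> 'a) set)))" (is "_ \<le> (\<Sum>v\<in>V. card (?B v))")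
  proof (rule sum_mono)
    fix v assume v: "v \<in> V"
    have "card (I - {a, p v}) = card I - 2"
      using a p[OF v] I by (subst card_Diff_subset) auto
    hence "card (vec_on (I - {a, p v}) :: ('i \<Rightarrow> 'a) set) = CARD('a) ^ (card I - 2)"
      using I by (simp add: card_vec_on)
    thus "CARD('a) ^ (card I - 2) * N \<le> card (?B v)"
      using N[OF p(2,3)[OF v]] by (simp add: card_cartesian_product)
  qed
  also have "\<dots> = card D"
    unfolding D_def using I finV
    by (subst card_SigmaI) (auto intro!: finite_cartesian_product finite_vec_on finite_symplectic_on)
  also have "\<dots> = card (h ` D)" using inj by (simp add: card_image)
  also have "\<dots> \<le> card (symplectic_on I :: ('i \<Rightarrow> 'i \<Rightarrow> 'a) set)"
    using I ext by (intro card_mono finite_symplectic_on) (auto simp: D_def)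
  finally show ?thesis .
qed

lemma card_symplectic_on_ge:
  fixes I :: "'i set"
  assumes two: "(2::'a::{field,finite}) = 0" and "finite I" and "card I = 2 * m"
  shows "(\<Prod>k<m. (CARD('a) ^ (2 * k + 1) - 1) * CARD('a) ^ (2 * k))
    \<le> card (symplectic_on I :: ('i \<Rightarrow> 'i \<Rightarrow> 'a) set)"
  using assms(2,3)
proof (induction m arbitrary: I)
  case 0
  \<comment> \<open>Here \<open>I\<close> is empty and nondegeneracy is vacuous, so the zero form
    counts.\<close>
  hence "(\<lambda>_ _. 0) \<in> (symplectic_on I :: ('i \<Rightarrow> 'i \<Rightarrow> 'a) set)"
    by (auto simp: symplectic_on_def alt_on_def)
  hence "card (symplectic_on I :: ('i \<Rightarrow> 'i \<Rightarrow> 'a) set) > 0"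
    using finite_symplectic_on[OF 0(1)] by (auto simp: card_gt_0_iff)
  thus ?case by simp
next
  case (Suc m)
  then obtain a where a: "a \<in> I" by fastforce
  have "(\<Prod>k<m. (CARD('a) ^ (2 * k + 1) - 1) * CARD('a) ^ (2 * k))
      \<le> card (symplectic_on (I - {a, b}) :: ('i \<Rightarrow> 'i \<Rightarrow> 'a) set)" if "b \<in> I" "b \<noteq> a" for b
    using Suc.prems a that by (intro Suc.IH) (auto simp: card_Diff_subset)
  from card_symplectic_on_step[OF two Suc.prems(1) a this] show ?case
    by (simp add: Suc.prems mult_ac)
qed

section \<open>From forms to matrices in \<open>M_set\<close>\<close>

lemma two_eq_zero_of_card:
  assumes "CARD('a::{field,finite}) = 2 ^ d"
  shows "(2::'a) = 0"
proof -
  interpret vector_space "F2_scale :: bit \<Rightarrow> 'a \<Rightarrow> 'a"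
    using vector_space_F2_scale[OF assms] .
  show ?thesis using scale_left_distrib[of 1 1 "1::'a"] by (simp add: F2_scale_def)
qed

definition form_mat :: "nat \<Rightarrow> (nat \<Rightarrow> nat \<Rightarrow> 'a) \<Rightarrow> 'a mat" where
  "form_mat n f = mat n n (\<lambda>(i, j). f i j)"

lemma inj_on_form_mat: "inj_on (form_mat n) (alt_on {..<n})"
proof (rule inj_onI, intro ext)
  fix f g :: "nat \<Rightarrow> nat \<Rightarrow> 'a::zero" and i j
  assume fg: "f \<in> alt_on {..<n}" "g \<in> alt_on {..<n}" and eq: "form_mat n f = form_mat n g"
  show "f i j = g i j"
  proof (cases "i < n \<and> j < n")
    case True
    thus ?thesis using arg_cong[OF eq, of "\<lambda>A. A $$ (i, j)"] by (simp add: form_mat_def)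
  next
    case False
    hence "i \<notin> {..<n} \<or> j \<notin> {..<n}" by simp
    thus ?thesis using fg by (simp add: alt_on_eq_0)
  qed
qed

text \<open>The hypothesis \<open>indep\<close> is condition (I) without coordinates. Entry
  \<open>j * d + k\<close> of the transposed expansion applied to \<open>v\<close> is the
  \<open>k\<close>-th coordinate of the sum, at column \<open>j\<close>, of the rows selected by
  \<open>v\<close>; the sum is zero once all its coordinates are.\<close>

lemma form_mat_in_M_set:
  fixes f :: "nat \<Rightarrow> nat \<Rightarrow> 'a::{field,finite}"
  assumes card: "CARD('a) = 2 ^ d" and basis: "is_F2_basis d bs" and f: "f \<in> alt_on {..<n}"
    and indep: "\<And>c :: nat \<Rightarrow> bit. \<forall>j<n. (\<Sum>i<n. of_bit (c i) * f i j) = 0 \<Longrightarrow> \<forall>i<n. c i = 0"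
  shows "form_mat n f \<in> M_set n bs"
proof -
  interpret vector_space "F2_scale :: bit \<Rightarrow> 'a \<Rightarrow> 'a"
    using vector_space_F2_scale[OF card] .
  have ind: "independent (set bs)" and sp: "span (set bs) = UNIV" and len: "length bs = d"
    using basis by (auto simp: is_F2_basis_def)
  let ?B = "form_mat n f"
  let ?E = "F2_expand bs ?B"
  have E: "?E \<in> carrier_mat n (n * d)"
    by (simp add: F2_expand_def form_mat_def len)
  have "vec_space.rank n ?E = n"
  proof (rule rank_eq_dim_row[OF E])
    fix v assume v: "v \<in> carrier_vec n" and z: "transpose_mat ?E *\<^sub>v v = 0\<^sub>v (n * d)"
    have "(\<Sum>i<n. of_bit (v $ i) * f i j) = 0" if j: "j < n" for j
    proof -
      let ?s = "\<Sum>i<n. F2_scale (v $ i) (f i j)"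
      have "representation (set bs) ?s b = 0" if "b \<in> set bs" for b
      proof -
        from that obtain k where k: "k < d" "b = bs ! k" using len by (auto simp: in_set_conv_nth)
        \<comment> \<open>The bound \<open>k < d\<close> also makes \<open>div\<close> and
          \<open>mod\<close> by \<open>d\<close> recover \<open>j\<close> and \<open>k\<close> from
          \<open>j * d + k\<close>.\<close>
        have jk: "j * d + k < n * d"
        proof -
          have "j * d + k < Suc j * d" using k by simp
          also have "\<dots> \<le> n * d" using j by (intro mult_right_mono) auto
          finally show ?thesis .
        qed
        have "representation (set bs) ?s b = (\<Sum>i<n. v $ i * representation (set bs) (f i j) b)"
          using ind sp by (simp add: representation_sum representation_scale)
        also have "\<dots> = (transpose_mat ?E *\<^sub>v v) $ (j * d + k)"
          using E v jk k j
          by (simp add: scalar_prod_def F2_expand_def F2_coord_def form_mat_def len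
              mult.commute lessThan_atLeast0 conj_commute)
        finally show ?thesis using z jk by simp
      qed
      hence "{b. representation (set bs) ?s b \<noteq> 0} = {}"
        using representation_ne_zero by blast
      with sum_nonzero_representation_eq[OF ind, of ?s] sp have "?s = 0" by simp
      thus ?thesis by (simp add: F2_scale_def)
    qed
    hence "\<forall>j<n. (\<Sum>i<n. of_bit (v $ i) * f i j) = 0" by blast
    hence "\<forall>i<n. v $ i = 0" by (rule indep)
    thus "v = 0\<^sub>v n" using v by (intro eq_vecI) auto
  qed
  moreover have "transpose_mat ?B = ?B" "\<forall>i<n. ?B $$ (i, i) = 0" "?B \<in> carrier_mat n n"
    using f by (auto simp: alt_on_def form_mat_def)
  ultimately show ?thesis by (simp add: M_set_def)
qed

lemma of_bit_eq_0_iff: "(of_bit c :: 'a::zero_neq_one) = 0 \<longleftrightarrow> c = 0"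
  by (cases c) auto

lemma card_M_set_ge_symplectic:
  fixes bs :: "'a::{field,finite} list"
  assumes "CARD('a) = 2 ^ d" and "is_F2_basis d bs"
  shows "card (symplectic_on {..<n} :: (nat \<Rightarrow> nat \<Rightarrow> 'a) set) \<le> card (M_set n bs)"
proof -
  let ?S = "symplectic_on {..<n} :: (nat \<Rightarrow> nat \<Rightarrow> 'a) set"
  have "inj_on (form_mat n) ?S"
    by (rule inj_on_subset[OF inj_on_form_mat]) (auto simp: symplectic_on_def)
  hence "card ?S = card (form_mat n ` ?S)" by (simp add: card_image)
  also have "\<dots> \<le> card (M_set n bs)"
  proof (intro card_mono finite_M_set subsetI)
    fix B assume "B \<in> form_mat n ` ?S"
    then obtain f where f: "f \<in> ?S" "B = form_mat n f" by auto
    have "\<forall>i<n. c i = 0" if "\<forall>j<n. (\<Sum>i<n. of_bit (c i) * f i j) = 0" for c :: "nat \<Rightarrow> bit"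
    proof -
      \<comment> \<open>This is nondegeneracy at the vector of the field elements
        \<open>of_bit (c i)\<close>.\<close>
      have "(\<forall>j\<in>{..<n}. (\<Sum>i<n. of_bit (c i) * f i j) = 0) \<longrightarrow>
          (\<forall>i\<in>{..<n}. (of_bit (c i) :: 'a) = 0)"
        using f(1) unfolding symplectic_on_def mem_Collect_eq by (elim conjE allE)
      with that have "\<forall>i\<in>{..<n}. (of_bit (c i) :: 'a) = 0" by simp
      thus ?thesis by (simp add: of_bit_eq_0_iff)
    qed
    moreover have "f \<in> alt_on {..<n}" using f(1) by (rule symplectic_on_imp_alt_on)
    ultimately show "B \<in> M_set n bs"
      unfolding f(2) using form_mat_in_M_set[OF assms, of f n] by blast
  qed
  finally show ?thesis .
qed

section \<open>Bordering by one row for odd size\<close>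

text \<open>For \<open>f\<close> and \<open>b\<close> extended by zero from \<open>{..<m}\<close>,
  the three terms have disjoint supports: the old block, row \<open>m\<close> and column
  \<open>m\<close>, with corner entry 0.\<close>

definition border :: "nat \<Rightarrow> (nat \<Rightarrow> nat \<Rightarrow> 'a::field) \<Rightarrow> (nat \<Rightarrow> 'a) \<Rightarrow> nat \<Rightarrow> nat \<Rightarrow> 'a" where
  "border m f b i j = f i j + (if i = m then b j else 0) + (if j = m then b i else 0)"

text \<open>In characteristic 2 the subset sums of the rows form their span over the prime
  field.\<close>

definition bit_combs :: "nat \<Rightarrow> (nat \<Rightarrow> nat \<Rightarrow> 'a::field) \<Rightarrow> (nat \<Rightarrow> 'a) set" where
  "bit_combs m f = (\<lambda>S j. \<Sum>i\<in>S. f i j) ` Pow {..<m}"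

lemma card_bit_combs_le: "card (bit_combs m f) \<le> 2 ^ m"
  unfolding bit_combs_def
  using card_image_le[of "Pow {..<m}" "\<lambda>S j. \<Sum>i\<in>S. f i j"] by (simp add: card_Pow)

text \<open>In a relation among the rows, look at the columns below \<open>m\<close>. If row
  \<open>m\<close> takes part, then \<open>b\<close> is a subset sum of rows of \<open>f\<close>,
  which is excluded; otherwise the relation is one of \<open>f\<close>, which is
  nondegenerate.\<close>

lemma border_in_M_set:
  fixes bs :: "'a::{field,finite} list"
  assumes card: "CARD('a) = 2 ^ d" and basis: "is_F2_basis d bs"
    and f: "f \<in> symplectic_on {..<m}" and b: "b \<in> vec_on {..<m}" "b \<notin> bit_combs m f"
  shows "border m f b \<in> alt_on {..<Suc m}" "form_mat (Suc m) (border m f b) \<in> M_set (Suc m) bs"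
proof -
  have neg: "x + y = 0 \<Longrightarrow> y = x" for x y :: 'a
    using two_eq_zero_of_card[OF card] by (metis add_left_cancel mult_2 mult_zero_left)
  have fs: "f i j = f j i" and fd: "f i i = 0" and f0: "\<not> i < m \<Longrightarrow> f i j = 0" for i j
    using f unfolding symplectic_on_def alt_on_def by auto
  have f0': "\<not> j < m \<Longrightarrow> f i j = 0" for i j using fs f0 by metis
  have fnd: "\<And>x. (\<forall>j\<in>{..<m}. (\<Sum>i<m. x i * f i j) = 0) \<Longrightarrow> \<forall>i\<in>{..<m}. x i = 0"
    using f unfolding symplectic_on_def by blast
  have b0: "\<not> j < m \<Longrightarrow> b j = 0" for j using b by (auto simp: vec_on_def)
  show alt: "border m f b \<in> alt_on {..<Suc m}"
    unfolding alt_on_def border_def using fs fd f0 b0 by auto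
  show "form_mat (Suc m) (border m f b) \<in> M_set (Suc m) bs"
  proof (rule form_mat_in_M_set[OF card basis alt])
    fix c :: "nat \<Rightarrow> bit"
    assume *: "\<forall>j<Suc m. (\<Sum>i<Suc m. of_bit (c i) * border m f b i j) = 0"
    have eq: "(\<Sum>i<m. of_bit (c i) * f i j) + of_bit (c m) * b j = 0" if "j < m" for j
      using *[rule_format, of j] that by (simp add: border_def f0)
    have cm: "c m = 0"
    proof (rule ccontr)
      assume "c m \<noteq> 0"
      hence "c m = 1" by simp
      define S where "S = {i \<in> {..<m}. c i = 1}"
      have "b = (\<lambda>j. \<Sum>i\<in>S. f i j)"
      proof
        fix j
        have "(\<Sum>i<m. of_bit (c i) * f i j) = (\<Sum>i<m. if c i = 1 then f i j else 0)"
          by (intro sum.cong) auto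
        also have "\<dots> = (\<Sum>i\<in>S. f i j)"
          unfolding S_def by (rule sum.inter_filter[symmetric]) simp
        finally have S: "(\<Sum>i<m. of_bit (c i) * f i j) = (\<Sum>i\<in>S. f i j)" .
        show "b j = (\<Sum>i\<in>S. f i j)"
        \<comment> \<open>For \<open>j < m\<close> the relation applies, with signs irrelevant in
          characteristic 2; beyond \<open>m\<close> both sides vanish by the extension by
          zero.\<close>
        proof (cases "j < m")
          case True
          have "(\<Sum>i\<in>S. f i j) + b j = 0" using eq[OF True] S \<open>c m = 1\<close> by simp
          thus ?thesis by (rule neg)
        qed (simp add: b0 f0')
      qed
      moreover have "S \<in> Pow {..<m}" by (auto simp: S_def)
      ultimately show False using b(2) by (auto simp: bit_combs_def)
    qed
    have "\<forall>i\<in>{..<m}. (of_bit (c i) :: 'a) = 0"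
    proof (rule fnd, rule ballI)
      fix j assume "j \<in> {..<m}"
      thus "(\<Sum>i<m. of_bit (c i) * f i j) = 0" using eq[of j] by (simp add: cm)
    qed
    hence "\<forall>i<m. c i = 0" by (simp add: of_bit_eq_0_iff)
    thus "\<forall>i<Suc m. c i = 0" using cm less_Suc_eq by blast
  qed
qed

lemma card_M_set_Suc_ge:
  fixes bs :: "'a::{field,finite} list"
  assumes "CARD('a) = 2 ^ d" and "is_F2_basis d bs"
  shows "(CARD('a) ^ m - 2 ^ m) * card (symplectic_on {..<m} :: (nat \<Rightarrow> nat \<Rightarrow> 'a) set)
    \<le> card (M_set (Suc m) bs)"
proof -
  let ?S = "symplectic_on {..<m} :: (nat \<Rightarrow> nat \<Rightarrow> 'a) set"
  define D where "D = (SIGMA f:?S. vec_on {..<m} - bit_combs m f)"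
  define h where "h = (\<lambda>(f :: nat \<Rightarrow> nat \<Rightarrow> 'a, b). form_mat (Suc m) (border m f b))"
  have inj: "inj_on h D"
  proof (rule inj_onI, clarify)
    fix f b f' b' assume D: "(f, b) \<in> D" "(f', b') \<in> D" and "h (f, b) = h (f', b')"
    moreover have "border m f b \<in> alt_on {..<Suc m}" "border m f' b' \<in> alt_on {..<Suc m}"
      using D by (auto simp: D_def intro: border_in_M_set(1)[OF assms])
    ultimately have eq: "border m f b = border m f' b'"
      using inj_onD[OF inj_on_form_mat] unfolding h_def prod.case by blast
    have "f \<in> ?S" "f' \<in> ?S" using D by (simp_all add: D_def)
    hence "f \<in> alt_on {..<m}" "f' \<in> alt_on {..<m}"
      by (simp_all only: symplectic_on_imp_alt_on)
    hence f0: "f i j = 0" "f' i j = 0" if "\<not> i < m \<or> \<not> j < m" for i j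
      using that by (simp_all add: alt_on_eq_0)
    have b0: "b j = 0" "b' j = 0" if "\<not> j < m" for j
      using D that by (auto simp: D_def vec_on_def)
    \<comment> \<open>Row \<open>m\<close> of the bordered form returns \<open>b\<close>, and the
      block below \<open>m\<close> returns \<open>f\<close>.\<close>
    have "b j = b' j" for j
      using fun_cong[OF fun_cong[OF eq], of m j] by (cases "j = m") (auto simp: border_def f0 b0)
    moreover have "f i j = f' i j" for i j
      using fun_cong[OF fun_cong[OF eq], of i j] by (cases "i < m \<and> j < m") (auto simp: border_def f0)
    ultimately show "f = f' \<and> b = b'" by blast
  qed
  have "(CARD('a) ^ m - 2 ^ m) * card ?S = (\<Sum>f\<in>?S. CARD('a) ^ m - 2 ^ m)" by simp
  also have "\<dots> \<le> (\<Sum>f\<in>?S. card (vec_on {..<m} - bit_combs m f))"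
  proof (rule sum_mono)
    fix f :: "nat \<Rightarrow> nat \<Rightarrow> 'a"
    \<comment> \<open>For any \<open>f\<close>, at most \<open>2 ^ m\<close> of the
      \<open>CARD('a) ^ m\<close> vectors are removed.\<close>
    show "CARD('a) ^ m - 2 ^ m \<le> card (vec_on {..<m} - bit_combs m f)"
      using diff_card_le_card_Diff[of "bit_combs m f" "vec_on {..<m}"] card_bit_combs_le[of m f]
        finite_vec_on[of "{..<m}"]
      by (simp add: bit_combs_def card_vec_on)
  qed
  also have "\<dots> = card D"
    unfolding D_def by (subst card_SigmaI) (auto intro!: finite_symplectic_on finite_vec_on)
  also have "\<dots> = card (h ` D)" using inj by (simp add: card_image)
  also have "\<dots> \<le> card (M_set (Suc m) bs)"
    using border_in_M_set(2)[OF assms]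
    by (intro card_mono finite_M_set) (auto simp: D_def h_def)
  finally show ?thesis .
qed

section \<open>The closed formula and the final bound\<close>

text \<open>From \<open>m\<close> to \<open>Suc m\<close> the binomial exponent grows by
  \<open>2 * m + (2 * m + 1)\<close>. The power \<open>q ^ (2 * m + 1)\<close> turns the new factor
  \<open>1 - q powi (- (2 * m + 1))\<close> into \<open>q ^ (2 * m + 1) - 1\<close>, and
  \<open>q ^ (2 * m)\<close> remains.\<close>

lemma symplectic_order_formula:
  fixes q :: real
  assumes "q \<noteq> 0"
  shows "q ^ ((2 * m) choose 2) * (\<Prod>j = 1..m. 1 - q powi (1 - 2 * int j))
    = (\<Prod>k<m. (q ^ (2 * k + 1) - 1) * q ^ (2 * k))"
proof (induction m)
  case (Suc m)
  have *: "(2 * Suc m) choose 2 = (2 * m choose 2) + 2 * m + (2 * m + 1)"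
    by (simp add: numeral_2_eq_2)
  have "q powi (1 - 2 * int (Suc m)) = inverse (q ^ (2 * m + 1))"
    (is "?r = _")
    using power_int_minus[of q "int (2 * m + 1)"] by (simp add: power_int_of_nat[symmetric])
  moreover have "x * (1 - inverse x) = x - 1" if "x \<noteq> 0" for x :: real
    using that by (simp add: right_diff_distrib)
  ultimately have r: "q ^ (2 * m + 1) * (1 - ?r) = q ^ (2 * m + 1) - 1"
    using assms by (metis power_not_zero)
  have "q ^ ((2 * Suc m) choose 2) * (\<Prod>j = 1..Suc m. 1 - q powi (1 - 2 * int j))
    = (q ^ ((2 * m) choose 2) * (\<Prod>j = 1..m. 1 - q powi (1 - 2 * int j)))
      * (q ^ (2 * m) * (q ^ (2 * m + 1) * (1 - ?r)))"
    unfolding * power_add[of q _ "2 * m + 1"] power_add[of q _ "2 * m"]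
    by (subst prod.nat_ivl_Suc') (simp_all only: mult_ac le_add1 plus_1_eq_Suc[symmetric])
  also have "\<dots> = (\<Prod>k<Suc m. (q ^ (2 * k + 1) - 1) * q ^ (2 * k))"
    unfolding r Suc.IH prod.lessThan_Suc by (simp only: mult_ac)
  finally show ?case .
qed (simp add: binomial_eq_0)

theorem proposition3p3:
  fixes n d :: nat and bs :: "'a::{field,finite} list"
  assumes "n \<ge> 2" and "d \<ge> 1"
    and "CARD('a) = 2 ^ d"
    and "is_F2_basis d bs"
  shows "nu n d \<le> real (card (M_set n bs))"
proof -
  define q where "q = (2::real) ^ d"
  define P where "P m = (\<Prod>k<m. (CARD('a) ^ (2 * k + 1) - 1) * CARD('a) ^ (2 * k))" for m :: nat
  have q: "real CARD('a) = q" "q \<noteq> 0" using assms(3) by (auto simp: q_def)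
  have "real (P m) = (\<Prod>k<m. (q ^ (2 * k + 1) - 1) * q ^ (2 * k))" for m
    \<comment> \<open>Powers of \<open>CARD('a)\<close> are at least 1, so the subtraction in
      \<open>nat\<close> agrees with the one in \<open>real\<close>.\<close>
    unfolding P_def by (simp add: of_nat_diff q)
  hence P: "q ^ ((2 * m) choose 2) * (\<Prod>j = 1..m. 1 - q powi (1 - 2 * int j)) = real (P m)" for m
    using symplectic_order_formula[OF q(2), of m] by simp
  have S: "P m \<le> card (symplectic_on {..<2 * m} :: (nat \<Rightarrow> nat \<Rightarrow> 'a) set)" for m
    unfolding P_def using two_eq_zero_of_card[OF assms(3)] by (intro card_symplectic_on_ge) auto
  show ?thesis
  proof (cases "even n")
    case True
    then obtain m where m: "n = 2 * m" by blast
    \<comment> \<open>The argument of the ceiling is \<open>m - 1/2\<close>; in the odd case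
      \<open>(n - 2) / 2\<close> has the same value, so both products have \<open>m\<close>
      factors.\<close>
    have "\<lceil>(real n - 1) / 2\<rceil> = int m" unfolding m by (rule ceiling_unique) auto
    hence "nu n d = real (P m)"
      using True P[of m] by (simp add: nu_def q_def Let_def m)
    also have "\<dots> \<le> card (M_set n bs)"
      using S[of m] card_M_set_ge_symplectic[OF assms(3,4), of n] m by simp
    finally show ?thesis .
  next
    case False
    then obtain m where m: "n = Suc (2 * m)" using oddE by (metis Suc_eq_plus1)
    have "\<lceil>(real n - 2) / 2\<rceil> = int m" unfolding m by (rule ceiling_unique) auto
    hence "nu n d = (q ^ (2 * m) - 2 ^ (2 * m)) * real (P m)"
      using False P[of m] by (simp add: nu_def q_def Let_def m mult.assoc)
    also have "q ^ (2 * m) - 2 ^ (2 * m) = real (CARD('a) ^ (2 * m) - 2 ^ (2 * m))"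
    proof -
      \<comment> \<open>Since \<open>d \<ge> 1\<close>, the field has at least 2 elements and the
        subtraction in \<open>nat\<close> is not truncated.\<close>
      have "(2::nat) ^ (2 * m) \<le> CARD('a) ^ (2 * m)"
        using assms(2,3) by (intro power_mono) (auto intro: self_le_power)
      thus ?thesis by (simp add: of_nat_diff q)
    qed
    also have "\<dots> * real (P m) \<le> card (M_set n bs)"
    proof -
      have "(CARD('a) ^ (2 * m) - 2 ^ (2 * m)) * P m \<le> card (M_set n bs)"
        using mult_le_mono2[OF S[of m]] card_M_set_Suc_ge[OF assms(3,4), of "2 * m"] m
        by (meson order_trans)
      thus ?thesis by (metis of_nat_le_iff of_nat_mult)
    qed
    finally show ?thesis .
  qed
qed

end
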